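(* Let $q\ge 2$ be the order of a finite field $\mathbb{F}_q$, let $1\le \ell\le m$ be integers and let $d\in\mathbb{R}$. Let $A=A_q^{(m,\ell,d)}$ be the DQI matrix, $\lambda_{\max}$ its largest eigenvalue, and $\mathbf{w}=(w_0,\dots,w_\ell)^T$ its normalized leading eigenvector ($A\mathbf{w}=\lambda_{\max}\mathbf{w}$, $\sum_k w_k^2=1$), and suppose $w_k>0$ for all $k\in\{0,\dots,\ell\}$. Let $\varepsilon_0,\dots,\varepsilon_\ell\in[0,1]$ be the decoding failure rates at Hamming layers $0,\dots,\ell$, and define $$\bar\varepsilon:=\sum_{k=0}^{\ell}\varepsilon_k w_k^2,\qquad \bar\eta:=\sum_{k=0}^{\ell}k\,\varepsilon_k w_k^2,$$ with $\bar\varepsilon<1$. Then, for uniformly random $\mathbf{v}\in\mathbb{F}_q^m$, the expected objective value $\mathbb{E}_{\mathbf{v}}\langle f\rangle$ achieved by DQI with imperfect decoding and coefficient vector $\mathbf{w}$ satisfies $$\mathbb{E}_{\mathbf{v}}\langle f\rangle\;\ge\;\frac{\lambda_{\max}(1-2\bar\varepsilon)+2d\,\bar\eta}{1-\bar\varepsilon}.$$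
   Context: DQI matrix: $A_q^{(m,\ell,d)}$ is the real symmetric tridiagonal $(\ell+1)\times(\ell+1)$ matrix, with rows and columns indexed by $0,\dots,\ell$, having diagonal entries $\alpha_k=kd$ for $0\le k\le \ell$ and off-diagonal entries (in positions $(k,k+1)$ and $(k+1,k)$) $a_{k+1}=\sqrt{(q-1)(k+1)(m-k)}$ for $0\le k\le \ell-1$. Here $m$ is the number of constraints, $\ell$ the polynomial degree, and $d$ a real offset parameter. Background: Decoded Quantum Interferometry (DQI) is a quantum algorithm for MAX-LINSAT: given $B\in\mathbb{F}_q^{m\times n}$ with rows $\mathbf{b}_i$ and a target $\mathbf{v}\in\mathbb{F}_q^m$, find $\mathbf{x}\in\mathbb{F}_q^n$ satisfying as many of the constraints $\mathbf{b}_i\cdot\mathbf{x}=v_i$ as possible; $f$ is the associated objective function. The algorithm prepares a degree-$\ell$ polynomial interference state with coefficient vector $\mathbf{w}$ using a classical decoder, and $\varepsilon_k$ is the failure rate of that decoder on errors of Hamming weight $k$. Model of the performance under imperfect decoding: the expectation over uniformly random $\mathbf{v}$ of the post-decoding matrix is $\mathbb{E}_{\mathbf{v}}\bar A=A_q^{(m,\ell,d)}-E$, where $E$ is a real symmetric tridiagonal matrix indexed by $0,\dots,\ell$ with zero diagonal and with off-diagonal entries satisfying $E_{k,k+1}\le(\varepsilon_k+\varepsilon_{k+1})\,a_{k+1}$ for $0\le k\le\ell-1$. The expected objective value with coefficient vector $\mathbf{w}$ is the quotient $$\mathbb{E}_{\mathbf{v}}\langle f\rangle=\frac{\mathbf{w}^T\,(A_q^{(m,\ell,d)}-E)\,\mathbf{w}}{\sum_{k=0}^{\ell}w_k^2(1-\varepsilon_k)}.$$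 For the purposes of this statement, $\mathbb{E}_{\mathbf{v}}\langle f\rangle$ is this quantity, for any $E$ with the stated properties. *)

theory Defs
  imports "Jordan_Normal_Form.Spectral_Radius"
begin

(* The entry in positions (k, k+1) and (k+1, k), i.e. a_{k+1} in the usual indexing.
   The difference m - k is taken in the reals. *)
definition dqi_offdiag :: "nat \<Rightarrow> nat \<Rightarrow> nat \<Rightarrow> real" where
  "dqi_offdiag q m k = sqrt ((real q - 1) * (real k + 1) * (real m - real k))"

definition dqi_matrix :: "nat \<Rightarrow> nat \<Rightarrow> nat \<Rightarrow> real \<Rightarrow> real mat" where
  "dqi_matrix q m l d = mat (l + 1) (l + 1) (\<lambda>(i, j).
     if i = j then real i * d
     else if j = i + 1 then dqi_offdiag q m i
     else if i = j + 1 then dqi_offdiag q m j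
     else 0)"

(* Intended for real symmetric matrices of positive dimension, whose spectrum is finite
   and nonempty. *)
definition largest_eigenvalue :: "real mat \<Rightarrow> real" where
  "largest_eigenvalue A = Max (spectrum A)"

definition tridiagonal_mat :: "'a::zero mat \<Rightarrow> bool" where
  "tridiagonal_mat A \<longleftrightarrow>
     (\<forall>i < dim_row A. \<forall>j < dim_col A. i + 1 < j \<or> j + 1 < i \<longrightarrow> A $$ (i, j) = 0)"

(* The matrices E admitted as the deviation of the averaged post-decoding matrix A - E from
   the DQI matrix A, given decoder failure rates eps. The entries of E are bounded only from
   above. *)
definition decoding_error_matrix ::
    "nat \<Rightarrow> nat \<Rightarrow> nat \<Rightarrow> (nat \<Rightarrow> real) \<Rightarrow> real mat \<Rightarrow> bool" where
  "decoding_error_matrix q m l eps E \<longleftrightarrow>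
     E \<in> carrier_mat (l + 1) (l + 1) \<and>
     transpose_mat E = E \<and>
     tridiagonal_mat E \<and>
     (\<forall>k \<le> l. E $$ (k, k) = 0) \<and>
     (\<forall>k < l. E $$ (k, k + 1) \<le> (eps k + eps (k + 1)) * dqi_offdiag q m k)"

(* The value of the objective, averaged over the target vector, in the imperfect-decoding model:
   the quadratic form of the averaged post-decoding matrix A - E at the coefficient vector w,
   divided by the squared norm of the state that survives decoding. *)
definition expected_objective ::
    "nat \<Rightarrow> nat \<Rightarrow> nat \<Rightarrow> real \<Rightarrow> (nat \<Rightarrow> real) \<Rightarrow> real mat \<Rightarrow> real vec \<Rightarrow> real" where
  "expected_objective q m l d eps E w =
     (w \<bullet> ((dqi_matrix q m l d - E) *\<^sub>v w)) / (\<Sum>k=0..l. (w $ k)\<^sup>2 * (1 - eps k))"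

end

theory Submission
  imports Defs
begin

text \<open>Write \<open>A = D + B\<close> with \<open>D = diag(k d)\<close> and \<open>B\<close> the off-diagonal part. Entrywise,
  \<open>E i j \<le> (eps i + eps j) * B i j\<close>, so for a nonnegative vector \<open>w\<close> the symmetry of \<open>B\<close> gives
  \<open>w \<bullet> E w \<le> 2 * (\<Sum>i. eps i * w i * (B w) i)\<close>. For an eigenvector,
  \<open>(B w) i = (lam - i d) * w i\<close>, which turns the right-hand side into
  \<open>2 * (lam * eps_bar - d * eta_bar)\<close>, while \<open>w \<bullet> A w = lam\<close>.\<close>

lemma quadratic_form_eq_double_sum:
  fixes M :: "'a::comm_semiring_0 mat"
  assumes "M \<in> carrier_mat n n" "w \<in> carrier_vec n"
  shows "w \<bullet> (M *\<^sub>v w) = (\<Sum>i<n. \<Sum>j<n. M $$ (i, j) * w $ i * w $ j)"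
  using assms
  by (auto simp: scalar_prod_def atLeast0LessThan sum_distrib_left ac_simps intro!: sum.cong)

text \<open>Exchanging the two sums and using the symmetry of \<open>B\<close> shows that the
  weights \<open>e j\<close> contribute as much as the weights \<open>e i\<close>. Keeping only
  \<open>e i\<close> leaves the row sums of \<open>B\<close> intact as inner sums, which is where an
  eigenvalue equation can be inserted.\<close>

lemma sum_symmetric_weights:
  fixes B :: "nat \<Rightarrow> nat \<Rightarrow> real"
  assumes "\<And>i j. i < n \<Longrightarrow> j < n \<Longrightarrow> B i j = B j i"
  shows "(\<Sum>i<n. \<Sum>j<n. (e i + e j) * B i j * x i * x j)
       = 2 * (\<Sum>i<n. e i * x i * (\<Sum>j<n. B i j * x j))"
proof -
  have swap: "(\<Sum>i<n. \<Sum>j<n. e j * B i j * x i * x j) = (\<Sum>i<n. \<Sum>j<n. e i * B i j * x i * x j)"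
    by (subst sum.swap) (auto intro!: sum.cong simp: assms)
  have "(\<Sum>i<n. \<Sum>j<n. (e i + e j) * B i j * x i * x j)
      = (\<Sum>i<n. \<Sum>j<n. e i * B i j * x i * x j) + (\<Sum>i<n. \<Sum>j<n. e j * B i j * x i * x j)"
    by (simp add: algebra_simps sum.distrib)
  then show ?thesis
    unfolding swap by (simp add: sum_distrib_left ac_simps)
qed

lemma dqi_matrix_carrier: "dqi_matrix q m l d \<in> carrier_mat (l + 1) (l + 1)"
  by (simp add: dqi_matrix_def)

lemma dqi_matrix_sym:
  "i \<le> l \<Longrightarrow> j \<le> l \<Longrightarrow> dqi_matrix q m l d $$ (i, j) = dqi_matrix q m l d $$ (j, i)"
  by (auto simp: dqi_matrix_def)

text \<open>The hypothesis on \<open>E\<close> bounds the superdiagonal only. Symmetry carries the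
  bound to the subdiagonal, and everywhere else both sides are zero. As the diagonal of the DQI
  matrix is masked, \<open>d\<close> is arbitrary.\<close>

lemma decoding_error_matrix_entry_le:
  assumes E: "decoding_error_matrix q m l eps E" and ij: "i \<le> l" "j \<le> l"
  shows "E $$ (i, j) \<le> (eps i + eps j) * (if i = j then 0 else dqi_matrix q m l d $$ (i, j))"
proof -
  have dims: "E \<in> carrier_mat (l + 1) (l + 1)" and "transpose_mat E = E"
    using E by (auto simp: decoding_error_matrix_def)
  then have sym: "E $$ (i, j) = E $$ (j, i)"
    using ij by (metis carrier_matD index_transpose_mat(1) less_Suc_eq_le Suc_eq_plus1)
  have off: "E $$ (k, k + 1) \<le> (eps k + eps (k + 1)) * dqi_offdiag q m k" if "k < l" for k
    using E that by (auto simp: decoding_error_matrix_def)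
  consider "i = j" | "j = i + 1" | "i = j + 1" | "i + 1 < j \<or> j + 1 < i"
    by linarith
  then show ?thesis
  proof cases
    case 1
    then show ?thesis using E ij by (auto simp: decoding_error_matrix_def)
  next
    case 2
    then show ?thesis using off[of i] ij by (simp add: dqi_matrix_def)
  next
    case 3
    then show ?thesis using off[of j] ij sym by (simp add: dqi_matrix_def add.commute)
  next
    case 4
    then show ?thesis using E ij dims
      by (auto simp: decoding_error_matrix_def tridiagonal_mat_def dqi_matrix_def)
  qed
qed

theorem theorem3p1:
  fixes F :: "('f, 'g) ring_scheme"
    and q m l :: nat and d lam eps_bar eta_bar :: real
    and A E :: "real mat" and w :: "real vec" and eps :: "nat \<Rightarrow> real"
  assumes F: "field F" "finite (carrier F)" "q = card (carrier F)"
    and q: "q \<ge> 2"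
    and l: "1 \<le> l" "l \<le> m"
    and A: "A = dqi_matrix q m l d"
    and lam: "lam = largest_eigenvalue A"
    and w_eigen: "eigenvector A w lam"
    and w_normalized: "(\<Sum>k=0..l. (w $ k)\<^sup>2) = 1"
    and w_pos: "\<forall>k \<le> l. w $ k > 0"
    and eps: "\<forall>k \<le> l. 0 \<le> eps k \<and> eps k \<le> 1"
    and eps_bar: "eps_bar = (\<Sum>k=0..l. eps k * (w $ k)\<^sup>2)"
    and eta_bar: "eta_bar = (\<Sum>k=0..l. real k * eps k * (w $ k)\<^sup>2)"
    and eps_bar_less: "eps_bar < 1"
    and E: "decoding_error_matrix q m l eps E"
  shows "expected_objective q m l d eps E w
           \<ge> (lam * (1 - 2 * eps_bar) + 2 * d * eta_bar) / (1 - eps_bar)"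
proof -
  let ?n = "l + 1"
  \<comment> \<open>The diagonal entries \<open>i * d\<close> can have either sign, while those of
    \<open>E\<close> vanish, so they are kept out of the comparison. They return through the
    eigenvalue equation and produce the \<open>eta_bar\<close> term.\<close>
  define B where "B i j = (if i = j then 0 else A $$ (i, j))" for i j
  have ivl: "{0..l} = {..<?n}" by auto
  have Ac: "A \<in> carrier_mat ?n ?n"
    unfolding A by (rule dqi_matrix_carrier)
  have Ec: "E \<in> carrier_mat ?n ?n"
    using E by (simp add: decoding_error_matrix_def)
  have wc: "w \<in> carrier_vec ?n" and Aw: "A *\<^sub>v w = lam \<cdot>\<^sub>v w"
    using w_eigen Ac by (auto simp: eigenvector_def)
  have "w \<bullet> (A *\<^sub>v w) = lam * (\<Sum>k=0..l. (w $ k)\<^sup>2)"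
    using wc by (simp add: Aw scalar_prod_def power2_eq_square atLeast0LessThan ivl
        sum_distrib_left ac_simps distrib_left)
  then have wAw: "w \<bullet> (A *\<^sub>v w) = lam"
    using w_normalized by simp
  have Bw: "(\<Sum>j<?n. B i j * w $ j) = (lam - real i * d) * w $ i" if i: "i < ?n" for i
  proof -
    have "(\<Sum>j<?n. A $$ (i, j) * w $ j) = (A *\<^sub>v w) $ i"
      using i wc Ac by (simp add: scalar_prod_def atLeast0LessThan)
    also have "\<dots> = lam * w $ i"
      using i wc by (simp add: Aw)
    finally have "(\<Sum>j<?n. A $$ (i, j) * w $ j) = lam * w $ i" .
    moreover have "A $$ (i, i) = real i * d"
      using i by (simp add: A dqi_matrix_def)
    \<comment> \<open>The diagonal term \<open>j = i\<close> is split off the row sum. Without the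
      deletion, \<open>sum.lessThan_Suc\<close> would peel off the index \<open>l\<close>
      instead.\<close>
    ultimately show ?thesis
      using i by (simp add: sum.remove[of "{..<Suc l}" i] B_def algebra_simps del: sum.lessThan_Suc)
  qed
  have E_le: "E $$ (i, j) \<le> (eps i + eps j) * B i j" if "i \<le> l" "j \<le> l" for i j
    unfolding B_def A by (rule decoding_error_matrix_entry_le[OF E that])
  have "w \<bullet> (E *\<^sub>v w) = (\<Sum>i<?n. \<Sum>j<?n. E $$ (i, j) * w $ i * w $ j)"
    by (rule quadratic_form_eq_double_sum[OF Ec wc])
  \<comment> \<open>The entries of \<open>E\<close> are bounded from above only, so the entrywise
    bound survives multiplication by \<open>w $ i\<close> and then \<open>w $ j\<close> because both
    are positive.\<close>
  also have "\<dots> \<le> (\<Sum>i<?n. \<Sum>j<?n. (eps i + eps j) * B i j * w $ i * w $ j)"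
    using E_le w_pos
    by (intro sum_mono mult_right_mono) (simp_all add: less_Suc_eq_le less_imp_le)
  also have "\<dots> = 2 * (\<Sum>i<?n. eps i * w $ i * (\<Sum>j<?n. B i j * w $ j))"
    by (rule sum_symmetric_weights) (auto simp: B_def A dqi_matrix_sym)
  also have "\<dots> = 2 * (\<Sum>i<?n. eps i * w $ i * ((lam - real i * d) * w $ i))"
    using Bw by simp
  also have "\<dots> = 2 * (lam * eps_bar - d * eta_bar)"
    by (simp add: eps_bar eta_bar ivl sum_distrib_left sum_subtractf power2_eq_square algebra_simps
        del: sum.lessThan_Suc)
  finally have wEw: "w \<bullet> (E *\<^sub>v w) \<le> 2 * (lam * eps_bar - d * eta_bar)" .
  have "w \<bullet> ((A - E) *\<^sub>v w) = lam - w \<bullet> (E *\<^sub>v w)"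
    using Ac Ec wc wAw
    by (metis minus_mult_distrib_mat_vec mult_mat_vec_carrier scalar_prod_minus_distrib)
  with wEw have num: "lam * (1 - 2 * eps_bar) + 2 * d * eta_bar \<le> w \<bullet> ((A - E) *\<^sub>v w)"
    by (simp add: algebra_simps)
  \<comment> \<open>Normalization of \<open>w\<close> identifies the denominator. It is positive by
    \<open>eps_bar < 1\<close>, so dividing preserves the bound on the numerator.\<close>
  have "(\<Sum>k=0..l. (w $ k)\<^sup>2 * (1 - eps k)) = 1 - eps_bar"
    using w_normalized by (simp add: eps_bar sum_subtractf algebra_simps)
  then show ?thesis
    using num eps_bar_less by (simp add: expected_objective_def A divide_right_mono)
qed

end
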